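(* Let $f:\Omega\subseteq\mathbb{E}_3\to\mathbb{R}$ be strongly differentiable at a point $\mathbf{x}_0$ internal to $\Omega$. Then $$\lim_{\substack{(\mathbf{a}_1,\mathbf{a}_2,\mathbf{a}_3,\mathbf{a}_4)\to(\mathbf{x}_0,\mathbf{x}_0,\mathbf{x}_0,\mathbf{x}_0)\\ \mathbf{a}_1,\mathbf{a}_2,\mathbf{a}_3,\mathbf{a}_4\text{ not coplanar}}}\Big(\overline{\Delta}f_{(\mathbf{a}_1,\mathbf{a}_2,\mathbf{a}_3,\mathbf{a}_4)}\Big)\big(\Delta_{(\mathbf{a}_1,\mathbf{a}_2,\mathbf{a}_3,\mathbf{a}_4)}\big)^{-1}=\nabla f(\mathbf{x}_0),$$ where the product and the inverse are those of the Clifford algebra $\mathbb{G}_3$, and the limit is taken over quadruples of points of $\Omega$ for which the mirrored points $\overline{\mathbf{a}_1},\overline{\mathbf{a}_2}$ also lie in $\Omega$ (which is automatic when the $\mathbf{a}_i$ are close enough to $\mathbf{x}_0$).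
   Context: $\mathbb{E}_n$ is the $n$-dimensional real Euclidean vector space with scalar product $\mathbf{u}\cdot\mathbf{v}$; its vectors are also called points. $\mathbb{G}_n=\mathcal{C}\ell(\mathbb{E}_n)$ is the Clifford (geometric) algebra generated by $\mathbb{E}_n$, an associative algebra of dimension $2^n$ with product denoted by juxtaposition and $\mathbf{v}\mathbf{v}=\mathbf{v}\cdot\mathbf{v}$ for every $\mathbf{v}\in\mathbb{E}_n$. For vectors, $\mathbf{u}_1\wedge\cdots\wedge\mathbf{u}_k=\frac1{k!}\sum_{\sigma\in\mathcal{S}_k}\epsilon_\sigma\,\mathbf{u}_{\sigma_1}\cdots\mathbf{u}_{\sigma_k}$, where $\epsilon_\sigma$ is the sign of the permutation $\sigma$. Strong differentiability: $f:\Omega\subseteq\mathbb{E}_n\to\mathbb{R}$ is strongly differentiable at $\mathbf{x}_0$ (a point internal to $\Omega$) if there is a vector $\mathbf{f^*}(\mathbf{x}_0)\in\mathbb{E}_n$ such that for each $\epsilon>0$ there is $\delta>0$ such that for all distinct $\mathbf{u},\mathbf{v}\in\Omega$ with $|\mathbf{u}-\mathbf{x}_0|<\delta$ and $|\mathbf{v}-\mathbf{x}_0|<\delta$ one has $|f(\mathbf{u})-f(\mathbf{v})-\mathbf{f^*}(\mathbf{x}_0)\cdot(\mathbf{u}-\mathbf{v})|<\epsilon|\mathbf{u}-\mathbf{v}|$. In that case $f$ is differentiable at $\mathbf{x}_0$ and $\mathbf{f^*}(\mathbf{x}_0)=\nabla f(\mathbf{x}_0)$. Let $\mathbf{a}_1,\dots,\mathbf{a}_4\in\mathbb{E}_3$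 be not coplanar, i.e. the vertices of a non degenerate tetrahedron. Define $$\Delta_{(\mathbf{a}_1,\mathbf{a}_2,\mathbf{a}_3,\mathbf{a}_4)}=(\mathbf{a}_2-\mathbf{a}_1)\wedge(\mathbf{a}_3-\mathbf{a}_1)\wedge(\mathbf{a}_4-\mathbf{a}_1),$$ which is invertible in $\mathbb{G}_3$. Let $\overline{\mathbf{a}_1}$ be the mirror image (orthogonal reflection) of $\mathbf{a}_1$ through the plane passing through $\mathbf{a}_2,\mathbf{a}_3,\mathbf{a}_4$, and let $\overline{\mathbf{a}_2}$ be the mirror image (orthogonal reflection) of $\mathbf{a}_2$ through the line passing through $\mathbf{a}_3,\mathbf{a}_4$; here the mirror image of a point $\mathbf{p}$ through an affine subspace is $2P(\mathbf{p})-\mathbf{p}$, with $P$ the orthogonal projection onto that affine subspace. The mean multi-difference pseudo-vector is $$\overline{\Delta}f_{(\mathbf{a}_1,\mathbf{a}_2,\mathbf{a}_3,\mathbf{a}_4)}=\tfrac14\Big\{[f(\overline{\mathbf{a}_1})-f(\mathbf{a}_1)](\overline{\mathbf{a}_2}-\mathbf{a}_2)\wedge(\mathbf{a}_4-\mathbf{a}_3)-[f(\overline{\mathbf{a}_2})-f(\mathbf{a}_2)](\overline{\mathbf{a}_1}-\mathbf{a}_1)\wedge(\mathbf{a}_4-\mathbf{a}_3)+[f(\mathbf{a}_4)-f(\mathbf{a}_3)](\overline{\mathbf{a}_1}-\mathbf{a}_1)\wedge(\overline{\mathbf{a}_2}-\mathbf{a}_2)\Big\}.$$ *)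

theory Defs
  imports "HOL-Analysis.Analysis" "HOL-Combinatorics.Permutations"
begin

section \<open>The Clifford algebra of Euclidean space\<close>

text \<open>
  The Clifford algebra of \<open>real ^ 'n\<close> is realised on the basis of blades
  \<open>e\<^sub>A = e\<^sub>a\<^sub>1 e\<^sub>a\<^sub>2 \<dots>\<close> with \<open>A = {a\<^sub>1 < a\<^sub>2 < \<dots>}\<close> a set of indices, where the \<open>e\<^sub>a\<close> are the
  standard basis vectors. The order on \<open>'n\<close> serves only to fix the order of these factors.
\<close>

typedef (overloaded) ('n::finite) multivector = "UNIV :: (real ^ 'n set) set"
  morphisms coeffs Multivector
  by simp

setup_lifting type_definition_multivector

lemma multivector_eqI: "(\<And>A. coeffs x $ A = coeffs y $ A) \<Longrightarrow> x = y"
  by (simp add: coeffs_inject[symmetric] vec_eq_iff)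

instantiation multivector :: (finite) euclidean_space
begin

lift_definition zero_multivector :: "'a multivector" is 0 .
lift_definition plus_multivector :: "'a multivector \<Rightarrow> 'a multivector \<Rightarrow> 'a multivector" is "(+)" .
lift_definition minus_multivector :: "'a multivector \<Rightarrow> 'a multivector \<Rightarrow> 'a multivector" is "(-)" .
lift_definition uminus_multivector :: "'a multivector \<Rightarrow> 'a multivector" is uminus .
lift_definition scaleR_multivector :: "real \<Rightarrow> 'a multivector \<Rightarrow> 'a multivector" is scaleR .
lift_definition inner_multivector :: "'a multivector \<Rightarrow> 'a multivector \<Rightarrow> real" is inner .
lift_definition norm_multivector :: "'a multivector \<Rightarrow> real" is norm .
lift_definition dist_multivector :: "'a multivector \<Rightarrow> 'a multivector \<Rightarrow> real" is dist .
lift_definition sgn_multivector :: "'a multivector \<Rightarrow> 'a multivector" is sgn .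
lift_definition Basis_multivector :: "'a multivector set" is Basis .

definition uniformity_multivector :: "('a multivector \<times> 'a multivector) filter" where
  "uniformity_multivector = (INF e\<in>{0<..}. principal {(x, y). dist x y < e})"

definition open_multivector :: "'a multivector set \<Rightarrow> bool" where
  "open_multivector U \<longleftrightarrow>
    (\<forall>x\<in>U. \<forall>\<^sub>F (x', y) in uniformity. x' = x \<longrightarrow> y \<in> U)"

instance
proof
  fix x y z :: "'a multivector" and a b :: real
  show "x + y + z = x + (y + z)" by transfer simp
  show "x + y = y + x" by transfer simp
  show "0 + x = x" by transfer simp
  show "- x + x = 0" by transfer simp
  show "x - y = x + - y" by transfer simp
  show "a *\<^sub>R (x + y) = a *\<^sub>R x + a *\<^sub>R y" by transfer (simp add: scaleR_add_right)
  show "(a + b) *\<^sub>R x = a *\<^sub>R x + b *\<^sub>R x" by transfer (simp add: scaleR_add_left)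
  show "a *\<^sub>R b *\<^sub>R x = (a * b) *\<^sub>R x" by transfer simp
  show "1 *\<^sub>R x = x" by transfer simp
  show "dist x y = norm (x - y)" by transfer (simp add: dist_norm)
  show "sgn x = inverse (norm x) *\<^sub>R x" by transfer (simp add: sgn_div_norm)
  show "inner x y = inner y x" by transfer (simp add: inner_commute)
  show "inner (x + y) z = inner x z + inner y z" by transfer (simp add: inner_add_left)
  show "inner (a *\<^sub>R x) y = a * inner x y" by transfer simp
  show "0 \<le> inner x x" by transfer simp
  show "inner x x = 0 \<longleftrightarrow> x = 0" by transfer simp
  show "norm x = sqrt (inner x x)" by transfer (simp add: norm_eq_sqrt_inner)
  show "(Basis :: 'a multivector set) \<noteq> {}" by transfer simp
  show "finite (Basis :: 'a multivector set)" by transfer simp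
  show "(\<forall>u\<in>Basis. inner x u = 0) \<longleftrightarrow> x = 0" by transfer (rule euclidean_all_zero_iff)
next
  fix u v :: "'a multivector"
  assume "u \<in> Basis" "v \<in> Basis"
  then show "inner u v = (if u = v then 1 else 0)" by transfer (rule inner_Basis)
qed (fact uniformity_multivector_def open_multivector_def)+

end

lemma DIM_multivector: "DIM('n::finite multivector) = 2 ^ CARD('n)"
proof -
  have "(Basis :: 'n multivector set) = Multivector ` Basis"
    unfolding Basis_multivector_def by auto
  moreover have "inj (Multivector :: _ \<Rightarrow> 'n multivector)"
    by (simp add: inj_on_def Multivector_inject)
  ultimately have "DIM('n multivector) = DIM(real ^ 'n set)"
    by (metis card_image inj_on_subset subset_UNIV)
  also have "\<dots> = card (Pow (UNIV :: 'n set))"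
    by simp
  finally show ?thesis
    by (simp only: card_Pow finite)
qed

text \<open>
  Sorting the product \<open>e\<^sub>A e\<^sub>B\<close> moves every factor \<open>e\<^sub>b\<close> past every \<open>e\<^sub>a\<close> with \<open>b < a\<close>, at
  the cost of one sign each; repeated factors then cancel since \<open>e\<^sub>a e\<^sub>a = 1\<close>, which leaves
  \<open>e\<^sub>C\<close> with \<open>C\<close> the symmetric difference of \<open>A\<close> and \<open>B\<close>.
\<close>

definition blade_sign :: "'n::linorder set \<Rightarrow> 'n set \<Rightarrow> real" where
  "blade_sign A B = (\<Prod>a\<in>A. \<Prod>b\<in>B. if b < a then - 1 else 1)"

lemma prod_sym_diff:
  fixes f :: "'a \<Rightarrow> real"
  assumes "finite A" "finite B" "\<And>x. f x * f x = 1"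
  shows "prod f (sym_diff A B) = prod f A * prod f B"
proof -
  have "prod f A = prod f (A - B) * prod f (A \<inter> B)"
    using assms by (metis Int_Diff_disjoint Int_commute Int_Diff_Un finite_Diff finite_Int mult.commute prod.union_disjoint)
  moreover have "prod f B = prod f (B - A) * prod f (A \<inter> B)"
    using assms by (metis Int_Diff_disjoint Int_commute Int_Diff_Un finite_Diff finite_Int mult.commute prod.union_disjoint)
  moreover have "prod f (A \<inter> B) * prod f (A \<inter> B) = 1"
    using assms by (simp flip: prod.distrib)
  moreover have "prod f (sym_diff A B) = prod f (A - B) * prod f (B - A)"
    using assms by (intro prod.union_disjoint) auto
  ultimately show ?thesis by (simp add: algebra_simps)
qed

lemma blade_sign_square: "blade_sign A B * blade_sign A B = 1"
  unfolding blade_sign_def by (simp flip: prod.distrib cong: if_cong) (auto intro!: prod.neutral)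

lemma blade_sign_sym_diff_left:
  fixes A :: "'n::{finite,linorder} set"
  shows "blade_sign (sym_diff A B) C = blade_sign A C * blade_sign B C"
  unfolding blade_sign_def
  by (rule prod_sym_diff) (auto simp flip: prod.distrib intro!: prod.neutral)

lemma blade_sign_sym_diff_right:
  fixes A :: "'n::{finite,linorder} set"
  shows "blade_sign A (sym_diff B C) = blade_sign A B * blade_sign A C"
proof -
  have "blade_sign A (sym_diff B C) =
    (\<Prod>a\<in>A. (\<Prod>b\<in>B. if b < a then - 1 else 1) * (\<Prod>b\<in>C. if b < a then - 1 else 1))"
    unfolding blade_sign_def by (intro prod.cong prod_sym_diff) auto
  then show ?thesis by (simp add: blade_sign_def prod.distrib)
qed

lemma blade_sign_empty [simp]: "blade_sign {} B = 1" "blade_sign A {} = 1"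
  by (simp_all add: blade_sign_def)

lemma sum_sym_diff_reindex:
  fixes f :: "'n::finite set \<Rightarrow> real"
  shows "(\<Sum>B\<in>UNIV. f (sym_diff A B)) = (\<Sum>B\<in>UNIV. f B)"
  by (rule sum.reindex_bij_witness[of _ "sym_diff A" "sym_diff A"]) (auto intro: arg_cong[where f=f])

instantiation multivector :: ("{finite,linorder}") real_algebra_1
begin

lift_definition one_multivector :: "'a multivector" is "\<chi> A. if A = {} then 1 else 0" .

lift_definition times_multivector :: "'a multivector \<Rightarrow> 'a multivector \<Rightarrow> 'a multivector" is
  "\<lambda>x y. \<chi> C. \<Sum>A\<in>UNIV. blade_sign A (sym_diff A C) * x $ A * y $ sym_diff A C" .

instance
proof
  fix x y z :: "'a multivector" and a :: real
  show "x * y * z = x * (y * z)"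
  proof (transfer, simp add: vec_eq_iff, intro allI)
    fix x y z :: "real ^ 'a set" and D :: "'a set"
    let ?s = "blade_sign :: 'a set \<Rightarrow> _" and ?d = "sym_diff :: 'a set \<Rightarrow> _"
    have eq: "?s A (?d A D) * x $ A * (?s (?d A E) (?d (?d A E) (?d A D)) * y $ ?d A E * z $ ?d (?d A E) (?d A D))
        = ?s E (?d E D) * (?s A (?d A E) * x $ A * y $ ?d A E) * z $ ?d E D" for A E
    proof -
      have 1: "?d (?d A E) (?d A D) = ?d E D" by blast
      have 2: "?d A D = ?d (?d A E) (?d E D)" by blast
      have 3: "?s A (?d A D) = ?s A (?d A E) * ?s A (?d E D)"
        unfolding 2 by (rule blade_sign_sym_diff_right)
      have 4: "?s (?d A E) (?d E D) = ?s A (?d E D) * ?s E (?d E D)"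
        by (rule blade_sign_sym_diff_left)
      have "?s A (?d A D) * ?s (?d A E) (?d E D) =
        ?s A (?d A E) * ?s E (?d E D) * (?s A (?d E D) * ?s A (?d E D))"
        unfolding 3 4 by (simp only: mult_ac)
      then have "?s A (?d A D) * ?s (?d A E) (?d E D) = ?s A (?d A E) * ?s E (?d E D)"
        unfolding blade_sign_square by simp
      then show ?thesis unfolding 1 by (simp add: algebra_simps)
    qed
    have "(\<Sum>A\<in>UNIV. ?s A (?d A D) * x $ A * (\<Sum>B\<in>UNIV. ?s B (?d B (?d A D)) * y $ B * z $ ?d B (?d A D)))
      = (\<Sum>A\<in>UNIV. ?s A (?d A D) * x $ A *
          (\<Sum>E\<in>UNIV. ?s (?d A E) (?d (?d A E) (?d A D)) * y $ ?d A E * z $ ?d (?d A E) (?d A D)))"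
      by (subst sum_sym_diff_reindex) (rule refl)
    also have "\<dots> = (\<Sum>A\<in>UNIV. \<Sum>E\<in>UNIV. ?s E (?d E D) * (?s A (?d A E) * x $ A * y $ ?d A E) * z $ ?d E D)"
      unfolding sum_distrib_left eq ..
    also have "\<dots> = (\<Sum>E\<in>UNIV. ?s E (?d E D) * (\<Sum>A\<in>UNIV. ?s A (?d A E) * x $ A * y $ ?d A E) * z $ ?d E D)"
      by (subst sum.swap) (simp only: sum_distrib_left sum_distrib_right)
    finally show "(\<Sum>A\<in>UNIV. ?s A (?d A D) * (\<Sum>B\<in>UNIV. ?s B (?d B A) * x $ B * y $ ?d B A) * z $ ?d A D)
      = (\<Sum>A\<in>UNIV. ?s A (?d A D) * x $ A * (\<Sum>B\<in>UNIV. ?s B (?d B (?d A D)) * y $ B * z $ ?d B (?d A D)))"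
      by (rule sym)
  qed
  show "1 * x = x"
    by transfer (simp add: vec_eq_iff if_distrib if_distribR sum.delta cong: if_cong)
  show "x * 1 = x"
  proof (transfer, simp add: vec_eq_iff, intro allI)
    fix x :: "real ^ 'a set" and C :: "'a set"
    have "(\<Sum>A\<in>UNIV. blade_sign A (sym_diff A C) * x $ A * (if A - C = {} \<and> C - A = {} then 1 else 0))
      = (\<Sum>A\<in>UNIV. if A = C then x $ A else 0)"
      by (intro sum.cong) auto
    then show "(\<Sum>A\<in>UNIV. blade_sign A (sym_diff A C) * x $ A * (if A \<subseteq> C \<and> C \<subseteq> A then 1 else 0)) = x $ C"
      by simp
  qed
  show "(x + y) * z = x * z + y * z"
    by transfer (simp add: vec_eq_iff algebra_simps sum.distrib)
  show "x * (y + z) = x * y + x * z"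
    by transfer (simp add: vec_eq_iff algebra_simps sum.distrib)
  show "a *\<^sub>R x * y = a *\<^sub>R (x * y)"
    by transfer (simp add: vec_eq_iff sum_distrib_left mult_ac)
  show "x * a *\<^sub>R y = a *\<^sub>R (x * y)"
    by transfer (simp add: vec_eq_iff sum_distrib_left mult_ac)
  show "(0::'a multivector) \<noteq> 1"
    by transfer (auto simp add: vec_eq_iff)
qed

end

lift_definition blade :: "'n::finite set \<Rightarrow> 'n multivector" is "\<lambda>A. axis A 1" .

definition mvec :: "real ^ 'n \<Rightarrow> 'n::finite multivector" where
  "mvec v = (\<Sum>i\<in>UNIV. (v $ i) *\<^sub>R blade {i})"

lemma blade_empty: "blade {} = 1"
  by transfer (auto simp: vec_eq_iff axis_def)

lemma blade_mult: "blade A * blade B = blade_sign A B *\<^sub>R blade (sym_diff A B)"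
proof (transfer, simp add: vec_eq_iff, intro allI)
  fix A B C :: "'a set"
  have "(\<Sum>D\<in>UNIV. blade_sign D (sym_diff D C) * axis A 1 $ D * axis B 1 $ sym_diff D C) =
    (\<Sum>D\<in>UNIV. if D = A then blade_sign A (sym_diff A C) * axis B 1 $ sym_diff A C else 0)"
    by (intro sum.cong) (auto simp: axis_def)
  also have "\<dots> = blade_sign A (sym_diff A C) * axis B 1 $ sym_diff A C"
    by simp
  also have "\<dots> = blade_sign A B * axis (sym_diff A B) 1 $ C"
  proof (cases "sym_diff A C = B")
    case True
    then have "sym_diff A B = C" by blast
    with True show ?thesis by (simp add: axis_def)
  next
    case False
    then have "sym_diff A B \<noteq> C" by blast
    with False show ?thesis by (simp add: axis_def)
  qed
  finally show "(\<Sum>D\<in>UNIV. blade_sign D (sym_diff D C) * axis A 1 $ D * axis B 1 $ sym_diff D C) =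
    blade_sign A B * axis (sym_diff A B) 1 $ C" .
qed

lemma linear_mvec: "linear mvec"
  by (rule linearI)
    (simp_all add: mvec_def scaleR_add_left sum.distrib scaleR_sum_right)

lemma mvec_axis: "mvec (axis i 1) = blade {i}"
proof -
  have "mvec (axis i 1) = (\<Sum>j\<in>UNIV. if j = i then blade {i} else 0)"
    unfolding mvec_def by (intro sum.cong) (auto simp: axis_def)
  then show ?thesis by simp
qed

text \<open>
  The next facts, with the dimension computed above, characterise the Clifford algebra:
  vectors square to their scalar square, and they generate the algebra.
\<close>

lemma mvec_square:
  fixes v :: "real ^ 'n::{finite,linorder}"
  shows "mvec v * mvec v = of_real (v \<bullet> v)"
proof -
  let ?b = "\<lambda>i j. (v $ i * v $ j) *\<^sub>R (blade {i} * blade {j} :: 'n multivector)"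
  have anti: "?b i j + ?b j i = (if i = j then 2 * (v $ i * v $ i) else 0) *\<^sub>R 1" for i j
  proof (cases "i = j")
    case True
    then show ?thesis
      by (simp add: blade_mult blade_sign_def blade_empty flip: scaleR_2)
  next
    case False
    have "sym_diff {i} {j} = {i, j}" "sym_diff {j} {i} = {i, j}" using False by auto
    with False show ?thesis
      by (auto simp: blade_mult blade_sign_def mult.commute)
  qed
  have vv: "mvec v * mvec v = (\<Sum>i\<in>UNIV. \<Sum>j\<in>UNIV. ?b i j)"
    by (simp add: mvec_def sum_product mult.commute)
  moreover have "\<dots> = (\<Sum>i\<in>UNIV. \<Sum>j\<in>UNIV. ?b j i)"
    by (rule sum.swap)
  ultimately have "2 *\<^sub>R (mvec v * mvec v) = (\<Sum>i\<in>UNIV. \<Sum>j\<in>UNIV. ?b i j + ?b j i)"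
    by (simp add: scaleR_2 sum.distrib)
  also have "\<dots> = (\<Sum>i\<in>UNIV. \<Sum>j\<in>UNIV. if j = i then (2 * (v $ i * v $ i)) *\<^sub>R 1 else 0)"
    unfolding anti by (intro sum.cong) auto
  also have "\<dots> = 2 *\<^sub>R of_real (v \<bullet> v)"
    by (simp add: inner_vec_def of_real_def scaleR_sum_left scaleR_sum_right)
  finally show ?thesis by simp
qed

lemma blade_eq_prod_list:
  fixes A :: "'n::{finite,linorder} set"
  shows "blade A = prod_list (map (\<lambda>i. mvec (axis i 1)) (sorted_list_of_set A))"
proof -
  have "blade (set is) = prod_list (map (\<lambda>i. mvec (axis i 1)) is)"
    if "sorted_wrt (<) is" for "is" :: "'n list"
    using that
  proof (induction "is")
    case Nil
    then show ?case by (simp add: blade_empty)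
  next
    case (Cons i "is")
    then have sd: "sym_diff {i} (set is) = set (i # is)" and bs: "blade_sign {i} (set is) = 1"
      by (auto simp: blade_sign_def intro!: prod.neutral)
    have "blade {i} * blade (set is) = blade (set (i # is))"
      unfolding blade_mult sd bs by simp
    moreover have "blade (set is) = prod_list (map (\<lambda>i. mvec (axis i 1)) is)"
      using Cons by simp
    ultimately show ?case
      by (simp only: mvec_axis list.map prod_list.Cons)
  qed
  from this[of "sorted_list_of_set A"] show ?thesis
    by simp
qed

lemma multivector_eq_sum_blades:
  fixes x :: "'n::finite multivector"
  shows "x = (\<Sum>A\<in>UNIV. (coeffs x $ A) *\<^sub>R blade A)"
proof (rule multivector_eqI)
  fix B
  have *: "coeffs (sum g S) = (\<Sum>A\<in>S. coeffs (g A))"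
    for g :: "'n set \<Rightarrow> 'n multivector" and S
    by (induction S rule: infinite_finite_induct)
      (simp_all add: zero_multivector.rep_eq plus_multivector.rep_eq)
  have "coeffs (\<Sum>A\<in>UNIV. (coeffs x $ A) *\<^sub>R blade A) $ B =
      (\<Sum>A\<in>UNIV. coeffs ((coeffs x $ A) *\<^sub>R blade A) $ B)"
    by (simp add: *)
  also have "\<dots> = (\<Sum>A\<in>UNIV. if A = B then coeffs x $ A else 0)"
    by (intro sum.cong) (auto simp: scaleR_multivector.rep_eq blade.rep_eq axis_def)
  finally show "coeffs x $ B = coeffs (\<Sum>A\<in>UNIV. (coeffs x $ A) *\<^sub>R blade A) $ B"
    by (simp only: sum.delta finite UNIV_I if_True)
qed

instantiation multivector :: ("{finite,linorder}") inverse
begin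

text \<open>The two-sided inverse; unspecified for non-invertible multivectors.\<close>

definition inverse_multivector :: "'a multivector \<Rightarrow> 'a multivector" where
  "inverse_multivector x = (THE y. x * y = 1 \<and> y * x = 1)"

definition divide_multivector :: "'a multivector \<Rightarrow> 'a multivector \<Rightarrow> 'a multivector" where
  "x div y = x * inverse (y :: 'a multivector)"

instance ..

end

lemma multivector_inverse_unique:
  fixes x :: "'n::{finite,linorder} multivector"
  assumes "x * y = 1" "y * x = 1"
  shows "inverse x = y"
  unfolding inverse_multivector_def
proof (rule the_equality)
  fix z
  assume z: "x * z = 1 \<and> z * x = 1"
  then have "z = (y * x) * z" using assms by simp
  also have "\<dots> = y" using z by (simp only: mult.assoc mult_1_right)
  finally show "z = y" .
qed (use assms in simp)

definition wedge :: "(real ^ 'n::{finite,linorder}) list \<Rightarrow> 'n multivector" where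
  "wedge us = (1 / fact (length us)) *\<^sub>R
    (\<Sum>\<sigma> | \<sigma> permutes {..<length us}.
      of_int (sign \<sigma>) * prod_list (map (\<lambda>i. mvec (us ! \<sigma> i)) [0..<length us]))"


section \<open>Strong differentiability and the gradient\<close>

definition strongly_differentiable ::
    "('a::euclidean_space \<Rightarrow> real) \<Rightarrow> 'a set \<Rightarrow> 'a \<Rightarrow> bool" where
  "strongly_differentiable f \<Omega> x\<^sub>0 \<longleftrightarrow>
    (\<exists>D. \<forall>\<epsilon>>0. \<exists>\<delta>>0. \<forall>u\<in>\<Omega>. \<forall>v\<in>\<Omega>.
      u \<noteq> v \<longrightarrow> norm (u - x\<^sub>0) < \<delta> \<longrightarrow> norm (v - x\<^sub>0) < \<delta> \<longrightarrow>
      \<bar>f u - f v - D \<bullet> (u - v)\<bar> < \<epsilon> * norm (u - v))"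

definition gradient :: "('a::euclidean_space \<Rightarrow> real) \<Rightarrow> 'a \<Rightarrow> 'a" where
  "gradient f x = (THE D. GDERIV f x :> D)"

lemma gradient_eqI:
  assumes "GDERIV f x :> D"
  shows "gradient f x = D"
  unfolding gradient_def
proof (rule the_equality)
  fix E
  assume "GDERIV f x :> E"
  with assms have "(\<lambda>h. h \<bullet> E) = (\<lambda>h. h \<bullet> D)"
    unfolding gderiv_def by (blast intro: has_derivative_unique)
  then have "\<forall>h. h \<bullet> E = h \<bullet> D"
    by (rule fun_cong[THEN allI])
  then show "E = D"
    by (simp only: vector_eq_ldot)
qed (fact assms)


section \<open>Mirror images and multi-differences\<close>

definition orth_proj :: "'a::euclidean_space set \<Rightarrow> 'a \<Rightarrow> 'a" where
  "orth_proj S p = (THE q. q \<in> S \<and> (\<forall>s\<in>S. orthogonal (p - q) (s - q)))"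

lemma orth_proj_eq_closest_point:
  fixes S :: "'a::euclidean_space set"
  assumes "affine S" "S \<noteq> {}"
  shows "orth_proj S p = closest_point S p"
  unfolding orth_proj_def
proof (rule the_equality)
  let ?q = "closest_point S p"
  have cl: "closed S" and cv: "convex S"
    using assms by (auto simp: affine_closed affine_imp_convex)
  have q: "?q \<in> S"
    using cl assms by (simp add: closest_point_in_set)
  have "orthogonal (p - ?q) (s - ?q)" if s: "s \<in> S" for s
  proof -
    have "2 *\<^sub>R ?q + (- 1) *\<^sub>R s \<in> S"
      using mem_affine[of S ?q s 2 "- 1"] assms(1) q s by simp
    then have "(p - ?q) \<bullet> (2 *\<^sub>R ?q + (- 1) *\<^sub>R s - ?q) \<le> 0" "(p - ?q) \<bullet> (s - ?q) \<le> 0"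
      using closest_point_dot[OF cv cl] s by blast+
    then show ?thesis
      by (simp add: orthogonal_def inner_simps)
  qed
  with q show "?q \<in> S \<and> (\<forall>s\<in>S. orthogonal (p - ?q) (s - ?q))"
    by blast
  fix r
  assume r: "r \<in> S \<and> (\<forall>s\<in>S. orthogonal (p - r) (s - r))"
  have "dist p r \<le> dist p s" if "s \<in> S" for s
  proof -
    have "orthogonal (p - r) (r - s)"
    proof -
      have "(p - r) \<bullet> (s - r) = 0"
        using r that by (simp only: orthogonal_def)
      then show ?thesis
        by (simp only: orthogonal_def inner_diff_right)
    qed
    then have "(norm ((p - r) + (r - s)))\<^sup>2 = (norm (p - r))\<^sup>2 + (norm (r - s))\<^sup>2"
      by (rule norm_add_Pythagorean)
    moreover have "(p - r) + (r - s) = p - s"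
      by simp
    ultimately have "(norm (p - s))\<^sup>2 = (norm (p - r))\<^sup>2 + (norm (r - s))\<^sup>2"
      by (simp only:)
    then have "(norm (p - r))\<^sup>2 \<le> (norm (p - s))\<^sup>2"
      using zero_le_power2[of "norm (r - s)"] by linarith
    then show ?thesis
      unfolding dist_norm by (rule power2_le_imp_le) (rule norm_ge_zero)
  qed
  then show "r = ?q"
    using closest_point_unique[OF cv cl, of r p] r by simp
qed

definition mirror :: "'a::euclidean_space set \<Rightarrow> 'a \<Rightarrow> 'a" where
  "mirror S p = 2 *\<^sub>R orth_proj S p - p"

definition mirror1 :: "real ^ 3 \<Rightarrow> real ^ 3 \<Rightarrow> real ^ 3 \<Rightarrow> real ^ 3 \<Rightarrow> real ^ 3" where
  "mirror1 a1 a2 a3 a4 = mirror (affine hull {a2, a3, a4}) a1"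

definition mirror2 :: "real ^ 3 \<Rightarrow> real ^ 3 \<Rightarrow> real ^ 3 \<Rightarrow> real ^ 3" where
  "mirror2 a2 a3 a4 = mirror (affine hull {a3, a4}) a2"

definition Delta :: "real ^ 3 \<Rightarrow> real ^ 3 \<Rightarrow> real ^ 3 \<Rightarrow> real ^ 3 \<Rightarrow> 3 multivector" where
  "Delta a1 a2 a3 a4 = wedge [a2 - a1, a3 - a1, a4 - a1]"

definition mean_Delta ::
    "(real ^ 3 \<Rightarrow> real) \<Rightarrow> real ^ 3 \<Rightarrow> real ^ 3 \<Rightarrow> real ^ 3 \<Rightarrow> real ^ 3 \<Rightarrow> 3 multivector" where
  "mean_Delta f a1 a2 a3 a4 =
    (let b1 = mirror1 a1 a2 a3 a4; b2 = mirror2 a2 a3 a4 in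
      (1 / 4) *\<^sub>R
        ((f b1 - f a1) *\<^sub>R wedge [b2 - a2, a4 - a3]
         - (f b2 - f a2) *\<^sub>R wedge [b1 - a1, a4 - a3]
         + (f a4 - f a3) *\<^sub>R wedge [b1 - a1, b2 - a2]))"

end

theory Submission
  imports Defs
begin

text \<open>
  Put \<open>u = b1 - a1\<close>, \<open>v = b2 - a2\<close> and \<open>w = a4 - a3\<close>, where \<open>b1\<close> and \<open>b2\<close> are the mirror
  images of \<open>a1\<close> and \<open>a2\<close>. Reflection makes these three vectors mutually orthogonal: \<open>u\<close> is normal
  to the plane through \<open>a2\<close>, \<open>a3\<close>, \<open>a4\<close>, while \<open>v\<close> lies in the direction of that plane and is normal
  to the edge direction \<open>w\<close>. None of them vanishes when the tetrahedron is non-degenerate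
  (\<open>mirror_frame\<close>).

  Up to multiples of later frame vectors, the edges \<open>a2 - a1\<close>, \<open>a3 - a2\<close>, \<open>a4 - a3\<close> are \<open>u / 2\<close>,
  \<open>v / 2\<close>, \<open>w\<close>, so that \<open>Delta = u v w / 4\<close> as a Clifford product (\<open>wedge3_triangular\<close>). Orthogonal vectors
  anticommute, hence \<open>w v u\<close> is a scalar multiple of the inverse, and multiplying out the three
  terms of the mean multi-difference leaves a single vector (\<open>mean_Delta_quotient\<close>):
  \<open>(f b1 - f a1) u / |u|\<^sup>2 + (f b2 - f a2) v / |v|\<^sup>2 + (f a4 - f a3) w / |w|\<^sup>2\<close>.

  If each increment of \<open>f\<close> is replaced by the scalar product of \<open>D = \<nabla>f(x\<^sub>0)\<close> with the corresponding
  frame vector, this is the expansion of \<open>D\<close> in the orthogonal basis \<open>u, v, w\<close>. Strong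
  differentiability bounds the errors of the increments by \<open>\<epsilon> |u|\<close>, \<open>\<epsilon> |v|\<close>, \<open>\<epsilon> |w|\<close>, so the total
  error is below \<open>3 \<epsilon>\<close>, however flat the tetrahedron is (\<open>orthogonal_frame_error\<close>).
  Strong differentiability at \<open>x\<^sub>0\<close> applies because \<open>b1\<close> and \<open>b2\<close> tend to \<open>x\<^sub>0\<close> with the vertices: a
  reflection moves a point by at most twice its distance to any point of the mirror
  (\<open>norm_mirror_le\<close>).
\<close>

section \<open>Exterior products of two and three vectors\<close>

lemma wedge2: "wedge [x, y] = (1/2) *\<^sub>R (mvec x * mvec y - mvec y * mvec x)"
proof -
  have f12: "finite {Suc 0}" "0 \<notin> {Suc 0}" by auto
  have s: "{..<length [x,y]} = insert 0 {Suc 0}" by auto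
  show ?thesis
    unfolding wedge_def s
    unfolding sum_over_permutations_insert[OF f12] permutes_sing
    by (simp add: sign_swap_id sign_id numeral_2_eq_2 algebra_simps)
qed

lemma wedge3:
  "wedge [x, y, z] = (1/6) *\<^sub>R
    (mvec x * mvec y * mvec z - mvec x * mvec z * mvec y
     + mvec y * mvec z * mvec x - mvec y * mvec x * mvec z
     + mvec z * mvec x * mvec y - mvec z * mvec y * mvec x)"
proof -
  have f1: "finite {1::nat, 2}" "0 \<notin> {1::nat, 2}" by auto
  have f2: "finite {2::nat}" "1 \<notin> {2::nat}" by auto
  have s: "{..<length [x,y,z]} = insert 0 {1, 2}" by auto
  have r: "[0..<length [x,y,z]] = [0,1,2]" by (simp add: upt_rec)
  show ?thesis
    unfolding wedge_def s r
    unfolding sum_over_permutations_insert[OF f1] sum_over_permutations_insert[OF f2] permutes_sing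
    by (simp add: sign_swap_id sign_id sign_compose permutation_swap_id fact_numeral
        transpose_apply_other mult.assoc algebra_simps)
qed

text \<open>
  Polarisation of \<open>mvec x * mvec x = x \<bullet> x\<close>, applied to \<open>x + y\<close>.
\<close>

lemma mvec_anticommute:
  fixes x y :: "real ^ 'n::{finite,linorder}"
  assumes "orthogonal x y"
  shows "mvec y * mvec x = - (mvec x * mvec y)"
proof -
  have "mvec (x + y) * mvec (x + y) = of_real (x \<bullet> x + y \<bullet> y)"
    using assms unfolding mvec_square orthogonal_def
    by (simp add: inner_add_left inner_add_right inner_commute)
  then show ?thesis
    by (simp add: linear_add[OF linear_mvec] algebra_simps mvec_square add_eq_0_iff)
qed

lemma wedge2_orthogonal:
  "orthogonal x y \<Longrightarrow> wedge [x, y] = mvec x * mvec y"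
  by (simp add: wedge2 mvec_anticommute[of x y] flip: scaleR_2)

text \<open>
  The exterior product is multilinear and alternating, so for edge vectors that are triangular with
  respect to an orthogonal frame only the diagonal coefficients survive, as in a triangular
  determinant. The edges \<open>x\<close>, \<open>y\<close>, \<open>z\<close> all start at one vertex of a tetrahedron; the hypotheses
  describe the path of edges \<open>x\<close>, \<open>y - x\<close>, \<open>z - y\<close> along its vertices.
\<close>

lemma wedge3_triangular:
  fixes u v w :: "real ^ 'n::{finite,linorder}"
  assumes "orthogonal u v" "orthogonal u w" "orthogonal v w"
    and "x = a *\<^sub>R u + s *\<^sub>R v + t *\<^sub>R w" "y = x + b *\<^sub>R v + r *\<^sub>R w" "z = y + c *\<^sub>R w"
  shows "wedge [x, y, z] = (a * b * c) *\<^sub>R (mvec u * mvec v * mvec w)"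
proof -
  define U V W where "U = mvec u" and "V = mvec v" and "W = mvec w"
  \<comment> \<open>Oriented as rewrite rules that sort every product of frame vectors into the order \<open>U V W\<close>.\<close>
  have anti: "V * U = - (U * V)" "W * U = - (U * W)" "W * V = - (V * W)"
    using assms by (auto simp: U_def V_def W_def mvec_anticommute)
  have anti': "V * (U * Z) = - (U * (V * Z))" "W * (U * Z) = - (U * (W * Z))" "W * (V * Z) = - (V * (W * Z))" for Z
    using anti by (simp_all flip: mult.assoc)
  have X: "mvec x = a *\<^sub>R U + s *\<^sub>R V + t *\<^sub>R W"
     "mvec y = mvec x + (b *\<^sub>R V + r *\<^sub>R W)"
     "mvec z = mvec y + c *\<^sub>R W"
    by (simp_all add: assms(4-) linear_add[OF linear_mvec] linear_scale[OF linear_mvec] U_def V_def W_def)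
  have shear: "wedge [x, y, z] = wedge [x, b *\<^sub>R v + r *\<^sub>R w, c *\<^sub>R w]"
    unfolding wedge3 X(2,3)
    by (simp add: linear_add[OF linear_mvec] linear_scale[OF linear_mvec] U_def V_def W_def algebra_simps)
  show ?thesis
    unfolding shear unfolding wedge3 X(1) 
    apply (simp add: linear_add[OF linear_mvec] linear_scale[OF linear_mvec] flip: U_def V_def W_def)
    by (simp add: algebra_simps anti anti' flip: scaleR_add_left)
qed

section \<open>Expansion in an orthogonal basis\<close>

text \<open>
  The remainder \<open>r\<close> is orthogonal to \<open>B\<close>; were it nonzero, \<open>insert r B\<close> would be an independent set
  with more than \<open>DIM('a)\<close> elements.
\<close>

lemma orthogonal_basis_expansion:
  fixes B :: "'a::euclidean_space set"
  assumes "pairwise orthogonal B" "0 \<notin> B" "finite B" "card B = DIM('a)"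
  shows "x = (\<Sum>b\<in>B. ((x \<bullet> b) / (b \<bullet> b)) *\<^sub>R b)"
proof (rule ccontr)
  define r where "r = x - (\<Sum>b\<in>B. ((x \<bullet> b) / (b \<bullet> b)) *\<^sub>R b)"
  assume "\<not> ?thesis"
  then have "r \<noteq> 0" by (simp add: r_def)
  have r: "orthogonal r c" if "c \<in> B" for c
  proof -
    have "(\<Sum>b\<in>B. (x \<bullet> b) / (b \<bullet> b) * (b \<bullet> c)) = (\<Sum>b\<in>B. if b = c then x \<bullet> c else 0)"
      using assms(1,2) that by (intro sum.cong) (auto simp: pairwise_def orthogonal_def)
    then show ?thesis
      using that assms(3)
      by (simp add: r_def orthogonal_def inner_diff_left inner_sum_left)
  qed
  then have "r \<notin> B"
    using \<open>r \<noteq> 0\<close> orthogonal_self by blast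
  have "pairwise orthogonal (insert r B)"
    using assms(1) r by (auto simp: pairwise_insert orthogonal_commute)
  then have "independent (insert r B)"
    using assms(2) \<open>r \<noteq> 0\<close> by (intro pairwise_orthogonal_independent) auto
  then have "card (insert r B) \<le> DIM('a)"
    by (rule independent_card_le)
  then show False
    using assms(3,4) \<open>r \<notin> B\<close> by simp
qed

section \<open>Reflections in affine subspaces\<close>

text \<open>
  The variational inequality of the closest point, used at \<open>s\<close> and at the point opposite to \<open>s\<close>
  with respect to the projection, becomes an equality.
\<close>

lemma orth_proj_affine:
  fixes S :: "'a::euclidean_space set"
  assumes "affine S" "S \<noteq> {}"
  shows orth_proj_in: "orth_proj S p \<in> S"
    and orth_proj_orthogonal: "s \<in> S \<Longrightarrow> orthogonal (p - orth_proj S p) (s - orth_proj S p)"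
proof -
  let ?q = "closest_point S p"
  have cl: "closed S" and cv: "convex S"
    using assms by (auto simp: affine_closed affine_imp_convex)
  have eq: "orth_proj S p = ?q"
    by (rule orth_proj_eq_closest_point[OF assms])
  show q: "orth_proj S p \<in> S"
    using cl assms by (simp add: eq closest_point_in_set)
  assume s: "s \<in> S"
  have "2 *\<^sub>R ?q + (- 1) *\<^sub>R s \<in> S"
    using mem_affine[of S ?q s 2 "- 1"] assms(1) q s eq by simp
  then have "(p - ?q) \<bullet> (2 *\<^sub>R ?q + (- 1) *\<^sub>R s - ?q) \<le> 0" "(p - ?q) \<bullet> (s - ?q) \<le> 0"
    using closest_point_dot[OF cv cl] s by blast+
  then show "orthogonal (p - orth_proj S p) (s - orth_proj S p)"
    by (simp add: eq orthogonal_def inner_simps)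
qed

lemma mirror_orthogonal:
  fixes S :: "'a::euclidean_space set"
  assumes "affine S" "s \<in> S" "t \<in> S"
  shows "orthogonal (mirror S p - p) (s - t)"
proof -
  have ne: "S \<noteq> {}" using assms by auto
  show ?thesis
    using orth_proj_orthogonal[OF assms(1) ne assms(2), of p] orth_proj_orthogonal[OF assms(1) ne assms(3), of p]
    by (simp add: mirror_def orthogonal_def inner_simps)
qed

lemma mirror_displacement: "mirror S p - p = 2 *\<^sub>R (orth_proj S p - p)"
  by (simp add: mirror_def scaleR_2 algebra_simps)

lemma mirror_midpoint:
  fixes S :: "'a::euclidean_space set"
  assumes "affine S" "S \<noteq> {}"
  shows "p + (1/2) *\<^sub>R (mirror S p - p) \<in> S"
  using orth_proj_in[OF assms, of p]
  by (simp add: mirror_displacement)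

text \<open>
  This keeps the mirrored vertices close to the base point of the limit.
\<close>

lemma norm_mirror_le:
  fixes S :: "'a::euclidean_space set"
  assumes "affine S" "s \<in> S"
  shows "norm (mirror S p - p) \<le> 2 * norm (s - p)"
proof -
  have ne: "S \<noteq> {}" using assms by auto
  have "norm (p - orth_proj S p) \<le> norm (p - s)"
    using closest_point_le[of S s p] assms ne
    by (simp add: orth_proj_eq_closest_point dist_norm affine_closed)
  then show ?thesis
    by (simp add: mirror_displacement norm_minus_commute)
qed

section \<open>The orthogonal frame of a tetrahedron\<close>

lemma noncoplanar_vertices:
  assumes "\<not> coplanar {a1, a2, a3, a4}"
  shows "a3 \<noteq> a4" "a2 \<notin> affine hull {a3, a4}" "a1 \<notin> affine hull {a2, a3, a4}"
proof -
  have nc: "\<not> {a1, a2, a3, a4} \<subseteq> affine hull {x, y, z}" for x y z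
    using assms by (auto simp: coplanar_def)
  show "a3 \<noteq> a4"
    using nc[of a1 a2 a3] by (auto simp: hull_inc)
  show "a2 \<notin> affine hull {a3, a4}"
    using nc[of a1 a3 a4] hull_mono[of "{a3, a4}" "{a1, a3, a4}" affine] by (auto simp: hull_inc)
  show "a1 \<notin> affine hull {a2, a3, a4}"
    using nc[of a2 a3 a4] by (auto simp: hull_inc)
qed

text \<open>
  The midpoints \<open>a1 + u / 2\<close> and \<open>a2 + v / 2\<close> are the feet of the perpendiculars, hence affine
  combinations of \<open>a2, a3, a4\<close> and of \<open>a3, a4\<close>. These combinations give the triangular relation
  between the edges of the tetrahedron and the frame; the factor \<open>1/4\<close> comes from the two halves.
\<close>

lemma mirror_frame:
  fixes a1 a2 a3 a4 :: "real ^ 3"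
  assumes "\<not> coplanar {a1, a2, a3, a4}"
  defines "u \<equiv> mirror1 a1 a2 a3 a4 - a1" and "v \<equiv> mirror2 a2 a3 a4 - a2" and "w \<equiv> a4 - a3"
  shows "u \<noteq> 0" "v \<noteq> 0" "w \<noteq> 0"
    and "orthogonal u v" "orthogonal u w" "orthogonal v w"
    and "Delta a1 a2 a3 a4 = (1/4) *\<^sub>R (mvec u * mvec v * mvec w)"
proof -
  define P where "P = affine hull {a2, a3, a4}"
  define L where "L = affine hull {a3, a4}"
  have P: "affine P" "a2 \<in> P" "a3 \<in> P" "a4 \<in> P" and L: "affine L" "a3 \<in> L" "a4 \<in> L"
    by (auto simp: P_def L_def hull_inc)
  have "L \<subseteq> P"
    unfolding P_def L_def by (rule hull_mono) auto
  have u: "u = mirror P a1 - a1" and v: "v = mirror L a2 - a2"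
    by (simp_all add: u_def v_def P_def L_def mirror1_def mirror2_def)
  have p: "a1 + (1/2) *\<^sub>R u \<in> P" and q: "a2 + (1/2) *\<^sub>R v \<in> L"
    unfolding u v using P L by (auto intro!: mirror_midpoint)
  show "u \<noteq> 0" "v \<noteq> 0" "w \<noteq> 0"
    using noncoplanar_vertices[OF assms(1)] p q by (auto simp: P_def L_def w_def)
  have uP: "orthogonal u (s - t)" if "s \<in> P" "t \<in> P" for s t
    unfolding u by (rule mirror_orthogonal[OF P(1) that])
  have "orthogonal u ((a2 + (1/2) *\<^sub>R v) - a2)"
    using uP \<open>L \<subseteq> P\<close> q P by blast
  then show uv: "orthogonal u v"
    by (simp add: orthogonal_def)
  show uw: "orthogonal u w"
    unfolding w_def using uP P by blast
  show vw: "orthogonal v w"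
    unfolding w_def v using mirror_orthogonal L by blast
  obtain c d where "c + d = 1" "a2 + (1/2) *\<^sub>R v = c *\<^sub>R a3 + d *\<^sub>R a4"
    using q unfolding L_def affine_hull_2 by auto
  then have "a2 + (1/2) *\<^sub>R v = (1 - d) *\<^sub>R a3 + d *\<^sub>R a4"
    by (simp add: eq_diff_eq)
  then have a3: "a3 = a2 + (1/2) *\<^sub>R v + (- d) *\<^sub>R w"
    by (simp add: w_def algebra_simps)
  have a4: "a4 = a3 + w"
    by (simp add: w_def)
  obtain x y z where xyz: "x + y + z = 1" "a1 + (1/2) *\<^sub>R u = x *\<^sub>R a2 + y *\<^sub>R a3 + z *\<^sub>R a4"
    using p unfolding P_def affine_hull_3 by auto
  then have x: "x = 1 - y - z" by simp
  have "a1 + (1/2) *\<^sub>R u = a2 + y *\<^sub>R (a3 - a2) + z *\<^sub>R (a4 - a2)"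
    unfolding xyz(2) x by (simp add: algebra_simps)
  also have "\<dots> = a2 + ((y + z) / 2) *\<^sub>R v + (z - d * (y + z)) *\<^sub>R w"
    unfolding a4 by (subst (1 2) a3) (simp add: algebra_simps add_divide_distrib)
  finally have "a2 - a1 = (1/2) *\<^sub>R u + (- ((y + z) / 2)) *\<^sub>R v + (- (z - d * (y + z))) *\<^sub>R w"
    by (simp add: algebra_simps)
  moreover have "a3 - a1 = (a2 - a1) + (1/2) *\<^sub>R v + (- d) *\<^sub>R w"
    by (subst a3) simp
  moreover have "a4 - a1 = (a3 - a1) + 1 *\<^sub>R w"
    by (simp add: a4)
  ultimately show "Delta a1 a2 a3 a4 = (1/4) *\<^sub>R (mvec u * mvec v * mvec w)"
    unfolding Delta_def using wedge3_triangular[OF uv uw vw] by fastforce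
qed

section \<open>The quotient of multi-differences is a vector\<close>

text \<open>
  Since \<open>w v u\<close> inverts \<open>u v w\<close> up to the factor \<open>|u|\<^sup>2 |v|\<^sup>2 |w|\<^sup>2\<close>, each bivector cancels the two frame
  vectors that it contains and leaves the third one. The negative sign in front of \<open>\<beta>\<close> makes up for
  the odd number of transpositions in \<open>(u w) (w v u) = - |w|\<^sup>2 |u|\<^sup>2 v\<close>.
\<close>

lemma orthogonal_frame_quotient:
  fixes u v w :: "real ^ 'n::{finite,linorder}"
  assumes nz: "u \<noteq> 0" "v \<noteq> 0" "w \<noteq> 0"
    and orth: "orthogonal u v" "orthogonal u w" "orthogonal v w"
  shows "((1/4) *\<^sub>R (\<alpha> *\<^sub>R wedge [v, w] - \<beta> *\<^sub>R wedge [u, w] + \<gamma> *\<^sub>R wedge [u, v]))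
      * inverse ((1/4) *\<^sub>R (mvec u * mvec v * mvec w))
    = mvec ((\<alpha> / (u \<bullet> u)) *\<^sub>R u + (\<beta> / (v \<bullet> v)) *\<^sub>R v + (\<gamma> / (w \<bullet> w)) *\<^sub>R w)"
proof -
  define U V W where "U = mvec u" and "V = mvec v" and "W = mvec w"
  define a b c where "a = u \<bullet> u" and "b = v \<bullet> v" and "c = w \<bullet> w"
  have abc: "a \<noteq> 0" "b \<noteq> 0" "c \<noteq> 0"
    using nz by (simp_all add: a_def b_def c_def)
  have sq: "U * U = a *\<^sub>R 1" "V * V = b *\<^sub>R 1" "W * W = c *\<^sub>R 1"
    by (simp_all add: U_def V_def W_def a_def b_def c_def mvec_square of_real_def)
  have sq': "U * (U * Z) = a *\<^sub>R Z" "V * (V * Z) = b *\<^sub>R Z" "W * (W * Z) = c *\<^sub>R Z" for Z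
    using sq by (simp_all flip: mult.assoc)
  have anti: "V * U = - (U * V)" "W * U = - (U * W)" "W * V = - (V * W)"
    using orth by (auto simp: U_def V_def W_def mvec_anticommute)
  have anti': "V * (U * Z) = - (U * (V * Z))" "W * (U * Z) = - (U * (W * Z))" "W * (V * Z) = - (V * (W * Z))" for Z
    using anti by (simp_all flip: mult.assoc)
  have inv: "inverse ((1/4) *\<^sub>R (U * V * W)) = (4 / (a * b * c)) *\<^sub>R (W * V * U)"
    using abc by (intro multivector_inverse_unique) (simp_all add: mult.assoc sq sq')
  show ?thesis
    using abc orth
    unfolding inv[unfolded U_def V_def W_def]
    by (simp add: wedge2_orthogonal linear_add[OF linear_mvec] linear_scale[OF linear_mvec]
          algebra_simps sq sq' anti anti'
        flip: U_def V_def W_def a_def b_def c_def)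
qed

lemma mean_Delta_quotient:
  assumes "\<not> coplanar {a1, a2, a3, a4}"
  defines "b1 \<equiv> mirror1 a1 a2 a3 a4" and "b2 \<equiv> mirror2 a2 a3 a4"
  shows "mean_Delta f a1 a2 a3 a4 * inverse (Delta a1 a2 a3 a4)
    = mvec (((f b1 - f a1) / ((b1 - a1) \<bullet> (b1 - a1))) *\<^sub>R (b1 - a1)
          + ((f b2 - f a2) / ((b2 - a2) \<bullet> (b2 - a2))) *\<^sub>R (b2 - a2)
          + ((f a4 - f a3) / ((a4 - a3) \<bullet> (a4 - a3))) *\<^sub>R (a4 - a3))"
  using orthogonal_frame_quotient[OF mirror_frame(1-6)[OF assms(1)]]
  unfolding mirror_frame(7)[OF assms(1)] mean_Delta_def Let_def b1_def b2_def .

section \<open>Passage to the limit\<close>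

text \<open>
  Each coefficient error is divided by the squared length of the frame vector and multiplied by the
  vector itself; an error proportional to that length therefore contributes at most \<open>\<epsilon>\<close>. This is
  why the bound does not depend on the shape of the frame.
\<close>

lemma orthogonal_frame_error:
  fixes u v w D :: "real ^ 3"
  assumes nz: "u \<noteq> 0" "v \<noteq> 0" "w \<noteq> 0"
    and orth: "orthogonal u v" "orthogonal u w" "orthogonal v w"
    and err: "\<bar>\<alpha> - D \<bullet> u\<bar> < \<epsilon> * norm u" "\<bar>\<beta> - D \<bullet> v\<bar> < \<epsilon> * norm v" "\<bar>\<gamma> - D \<bullet> w\<bar> < \<epsilon> * norm w"
  shows "norm ((\<alpha> / (u \<bullet> u)) *\<^sub>R u + (\<beta> / (v \<bullet> v)) *\<^sub>R v + (\<gamma> / (w \<bullet> w)) *\<^sub>R w - D) < 3 * \<epsilon>"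
proof -
  have ne: "u \<noteq> v" "u \<noteq> w" "v \<noteq> w"
    using nz orth by (auto simp: orthogonal_def)
  have "D = (\<Sum>b\<in>{u, v, w}. ((D \<bullet> b) / (b \<bullet> b)) *\<^sub>R b)"
    using nz orth ne
    by (intro orthogonal_basis_expansion) (auto simp: pairwise_insert orthogonal_commute)
  then have D: "D = ((D \<bullet> u) / (u \<bullet> u)) *\<^sub>R u + ((D \<bullet> v) / (v \<bullet> v)) *\<^sub>R v + ((D \<bullet> w) / (w \<bullet> w)) *\<^sub>R w"
    using ne by (simp add: add.assoc)
  have small: "norm (((t - D \<bullet> x) / (x \<bullet> x)) *\<^sub>R x) < \<epsilon>" if "x \<noteq> 0" "\<bar>t - D \<bullet> x\<bar> < \<epsilon> * norm x" for t x
    using that by (simp add: dot_square_norm power2_eq_square divide_simps)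
  have diff: "(\<alpha> / (u \<bullet> u)) *\<^sub>R u + (\<beta> / (v \<bullet> v)) *\<^sub>R v + (\<gamma> / (w \<bullet> w)) *\<^sub>R w - D
    = ((\<alpha> - D \<bullet> u) / (u \<bullet> u)) *\<^sub>R u + ((\<beta> - D \<bullet> v) / (v \<bullet> v)) *\<^sub>R v + ((\<gamma> - D \<bullet> w) / (w \<bullet> w)) *\<^sub>R w"
    unfolding diff_divide_distrib scaleR_diff_left using D by (simp add: algebra_simps)
  show ?thesis
    unfolding diff
    using small[OF nz(1) err(1)] small[OF nz(2) err(2)] small[OF nz(3) err(3)]
      norm_triangle_ineq[of "((\<alpha> - D \<bullet> u) / (u \<bullet> u)) *\<^sub>R u + ((\<beta> - D \<bullet> v) / (v \<bullet> v)) *\<^sub>R v" "((\<gamma> - D \<bullet> w) / (w \<bullet> w)) *\<^sub>R w"]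
      norm_triangle_ineq[of "((\<alpha> - D \<bullet> u) / (u \<bullet> u)) *\<^sub>R u" "((\<beta> - D \<bullet> v) / (v \<bullet> v)) *\<^sub>R v"]
    by linarith
qed

text \<open>
  Fixing the second point at \<open>x\<^sub>0\<close>, which lies in \<open>\<Omega>\<close> together with a whole ball, turns the strong
  derivative into the usual one.
\<close>

lemma strong_derivative_gradient:
  assumes "x\<^sub>0 \<in> interior \<Omega>"
    and D: "\<And>\<epsilon>. \<epsilon> > 0 \<Longrightarrow> \<exists>\<delta>>0. \<forall>u\<in>\<Omega>. \<forall>v\<in>\<Omega>.
      u \<noteq> v \<longrightarrow> norm (u - x\<^sub>0) < \<delta> \<longrightarrow> norm (v - x\<^sub>0) < \<delta> \<longrightarrow>
      \<bar>f u - f v - D \<bullet> (u - v)\<bar> < \<epsilon> * norm (u - v)"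
  shows "gradient f x\<^sub>0 = D"
proof (rule gradient_eqI)
  obtain r where r: "r > 0" "ball x\<^sub>0 r \<subseteq> \<Omega>"
    using assms(1) by (auto simp: mem_interior)
  have "\<exists>d>0. \<forall>y. norm (y - x\<^sub>0) < d \<longrightarrow> norm (f y - f x\<^sub>0 - (y - x\<^sub>0) \<bullet> D) \<le> e * norm (y - x\<^sub>0)"
    if e: "e > 0" for e
  proof -
    obtain d where d: "d > 0" "\<And>u v. u \<in> \<Omega> \<Longrightarrow> v \<in> \<Omega> \<Longrightarrow> u \<noteq> v \<Longrightarrow> norm (u - x\<^sub>0) < d \<Longrightarrow> norm (v - x\<^sub>0) < d \<Longrightarrow>
      \<bar>f u - f v - D \<bullet> (u - v)\<bar> < e * norm (u - v)"
      using D[OF e] by blast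
    have "norm (f y - f x\<^sub>0 - (y - x\<^sub>0) \<bullet> D) \<le> e * norm (y - x\<^sub>0)" if y: "norm (y - x\<^sub>0) < min d r" for y
    proof (cases "y = x\<^sub>0")
      case False
      have "y \<in> \<Omega>" "x\<^sub>0 \<in> \<Omega>"
        using r y by (auto simp: dist_norm norm_minus_commute)
      then show ?thesis
        using d(2)[of y x\<^sub>0] False y d(1) by (simp add: inner_commute)
    qed simp
    then show ?thesis
      using d(1) r(1) by (intro exI[of _ "min d r"]) auto
  qed
  then show "GDERIV f x\<^sub>0 :> D"
    unfolding gderiv_def has_derivative_at_alt
    by (auto intro: bounded_linear_inner_left)
qed

theorem theorem2:
  fixes f :: "real ^ 3 \<Rightarrow> real" and \<Omega> :: "(real ^ 3) set" and x\<^sub>0 :: "real ^ 3"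
  assumes "x\<^sub>0 \<in> interior \<Omega>"
    and "strongly_differentiable f \<Omega> x\<^sub>0"
  shows "((\<lambda>(a1, a2, a3, a4). mean_Delta f a1 a2 a3 a4 * inverse (Delta a1 a2 a3 a4))
      \<longlongrightarrow> mvec (gradient f x\<^sub>0))
    (at (x\<^sub>0, x\<^sub>0, x\<^sub>0, x\<^sub>0) within
      {(a1, a2, a3, a4). \<not> coplanar {a1, a2, a3, a4} \<and> {a1, a2, a3, a4} \<subseteq> \<Omega> \<and>
        mirror1 a1 a2 a3 a4 \<in> \<Omega> \<and> mirror2 a2 a3 a4 \<in> \<Omega>})"
    (is "(?F \<longlongrightarrow> _) (at ?x within ?S)")
proof -
  define g where "g = (\<lambda>(a1, a2, a3, a4). let b1 = mirror1 a1 a2 a3 a4; b2 = mirror2 a2 a3 a4 in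
      ((f b1 - f a1) / ((b1 - a1) \<bullet> (b1 - a1))) *\<^sub>R (b1 - a1)
      + ((f b2 - f a2) / ((b2 - a2) \<bullet> (b2 - a2))) *\<^sub>R (b2 - a2)
      + ((f a4 - f a3) / ((a4 - a3) \<bullet> (a4 - a3))) *\<^sub>R (a4 - a3))"
  obtain D where D: "\<And>\<epsilon>. \<epsilon> > 0 \<Longrightarrow> \<exists>\<delta>>0. \<forall>u\<in>\<Omega>. \<forall>v\<in>\<Omega>.
      u \<noteq> v \<longrightarrow> norm (u - x\<^sub>0) < \<delta> \<longrightarrow> norm (v - x\<^sub>0) < \<delta> \<longrightarrow>
      \<bar>f u - f v - D \<bullet> (u - v)\<bar> < \<epsilon> * norm (u - v)"
    using assms(2) unfolding strongly_differentiable_def by blast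
  have grad: "gradient f x\<^sub>0 = D"
    by (rule strong_derivative_gradient[OF assms(1) D])
  have "(g \<longlongrightarrow> D) (at ?x within ?S)"
    unfolding Lim_within
  proof (intro allI impI)
    fix e :: real assume "e > 0"
    then obtain d where d: "d > 0" "\<And>u v. u \<in> \<Omega> \<Longrightarrow> v \<in> \<Omega> \<Longrightarrow> u \<noteq> v \<Longrightarrow> norm (u - x\<^sub>0) < d \<Longrightarrow> norm (v - x\<^sub>0) < d \<Longrightarrow>
      \<bar>f u - f v - D \<bullet> (u - v)\<bar> < (e / 3) * norm (u - v)"
      using D[of "e / 3"] by auto
    \<comment> \<open>Vertices within \<open>d / 5\<close> of \<open>x\<^sub>0\<close> are less than \<open>2 d / 5\<close> apart, so a reflection moves them
      by less than \<open>4 d / 5\<close> and the mirrored points are still within \<open>d\<close>.\<close>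
    have "dist (g x) D < e" if "x \<in> ?S" and x: "dist x ?x < d / 5" for x
    proof -
      obtain a1 a2 a3 a4 where xeq: "x = (a1, a2, a3, a4)"
        by (metis prod.exhaust)
      define b1 b2 where "b1 = mirror1 a1 a2 a3 a4" and "b2 = mirror2 a2 a3 a4"
      have nc: "\<not> coplanar {a1, a2, a3, a4}" and
        in\<Omega>: "a1 \<in> \<Omega>" "a2 \<in> \<Omega>" "a3 \<in> \<Omega>" "a4 \<in> \<Omega>" "b1 \<in> \<Omega>" "b2 \<in> \<Omega>"
        using \<open>x \<in> ?S\<close> by (auto simp: xeq b1_def b2_def)
      note frame = mirror_frame[OF nc, folded b1_def b2_def]
      have a: "norm (a1 - x\<^sub>0) < d / 5" "norm (a2 - x\<^sub>0) < d / 5" "norm (a3 - x\<^sub>0) < d / 5" "norm (a4 - x\<^sub>0) < d / 5"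
        using x dist_fst_le[of x ?x] dist_snd_le[of x ?x]
          dist_fst_le[of "snd x" "snd ?x"] dist_snd_le[of "snd x" "snd ?x"]
          dist_fst_le[of "snd (snd x)" "snd (snd ?x)"] dist_snd_le[of "snd (snd x)" "snd (snd ?x)"]
        by (simp_all add: xeq dist_norm)
      have "norm (b1 - a1) \<le> 2 * norm (a2 - a1)" "norm (b2 - a2) \<le> 2 * norm (a3 - a2)"
        unfolding b1_def b2_def mirror1_def mirror2_def
        by (auto intro!: norm_mirror_le hull_inc)
      then have b: "norm (b1 - x\<^sub>0) < d" "norm (b2 - x\<^sub>0) < d"
        using a norm_triangle_ineq4[of "a2 - x\<^sub>0" "a1 - x\<^sub>0"] norm_triangle_ineq4[of "a3 - x\<^sub>0" "a2 - x\<^sub>0"]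
          norm_triangle_ineq[of "b1 - a1" "a1 - x\<^sub>0"] norm_triangle_ineq[of "b2 - a2" "a2 - x\<^sub>0"]
        by simp_all
      have "norm (g x - D) < 3 * (e / 3)"
        unfolding xeq g_def prod.case Let_def b1_def[symmetric] b2_def[symmetric]
        by (rule orthogonal_frame_error[OF frame(1-6)]; rule d(2))
           (use frame(1-3) in\<Omega> a b d(1) in auto)
      then show ?thesis by (simp add: dist_norm)
    qed
    then show "\<exists>d>0. \<forall>x\<in>?S. 0 < dist x ?x \<and> dist x ?x < d \<longrightarrow> dist (g x) D < e"
      using d(1) by (intro exI[of _ "d / 5"]) auto
  qed
  then have "((\<lambda>x. mvec (g x)) \<longlongrightarrow> mvec D) (at ?x within ?S)"
    by (rule bounded_linear.tendsto[rotated]) (simp add: linear_mvec flip: linear_conv_bounded_linear)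
  moreover have "\<forall>\<^sub>F x in at ?x within ?S. mvec (g x) = ?F x"
    unfolding eventually_at_filter
    by (rule always_eventually) (auto simp: g_def Let_def mean_Delta_quotient)
  ultimately show ?thesis
    unfolding grad by (rule Lim_transform_eventually)
qed

end
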